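(* Let $d\ge1$, $q\in(2,\infty)$ and $p=q/(q-1)$. Then $$\mathbf B_{q,d}=\sup_{0\ne f\in L^p(\mathbb R^d)}\frac{\|\widehat f\|_q}{\|f\|_{\mathcal L}}.$$
   Context: $|E|$ is Lebesgue measure and $1_E$ is the indicator function of $E$. The Fourier transform is $\widehat f(\xi)=\int_{\mathbb R^d}e^{-2\pi i x\cdot\xi}f(x)\,dx$, extended to $L^p(\mathbb R^d)$, $1<p<2$, via the Hausdorff-Young inequality. $$\mathbf B_{q,d}=\sup_{E}\ \sup_{|f|\le 1_E}\frac{\|\widehat f\|_q}{|E|^{1/p}},$$ where $E$ ranges over Lebesgue measurable subsets of $\mathbb R^d$ with $0<|E|<\infty$ and $f:\mathbb R^d\to\mathbb C$ over measurable functions with $|f|\le1_E$. For measurable $f:\mathbb R^d\to\mathbb C$, $$\|f\|_{\mathcal L}=\inf\Big\{\sum_n a_n:\ |f|=\sum_n a_n|E_n|^{-1/p}1_{E_n}\text{ a.e.},\ a_n\ge0,\ 0<|E_n|<\infty\Big\}$$ (countable sums, $E_n$ measurable), with $\|f\|_{\mathcal L}=\infty$ if there is no such representation with finite sum; the ratio is taken to be $0$ when $\|f\|_{\mathcal L}=\infty$. *)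

theory Defs
  imports "HOL-Analysis.Analysis"
begin

definition conj_exp :: "real \<Rightarrow> real" where
  "conj_exp p = p / (p - 1)"

definition ennreal_powr :: "ennreal \<Rightarrow> real \<Rightarrow> ennreal" where
  "ennreal_powr t s = (if t = \<infinity> then \<infinity> else ennreal (enn2real t powr s))"
  \<comment> \<open>only used with positive exponents s\<close>

definition Lp_norm :: "real \<Rightarrow> (real^'d::finite \<Rightarrow> complex) \<Rightarrow> ennreal" where
  "Lp_norm p f = ennreal_powr (\<integral>\<^sup>+ x. ennreal (cmod (f x) powr p) \<partial>lebesgue) (1 / p)"

definition Lp_fun :: "real \<Rightarrow> (real^'d::finite \<Rightarrow> complex) set" where
  "Lp_fun p = {f \<in> borel_measurable lebesgue. Lp_norm p f < \<infinity>}"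

definition fourier_integral :: "(real^'d::finite \<Rightarrow> complex) \<Rightarrow> real^'d \<Rightarrow> complex" where
  "fourier_integral f \<xi> =
     (LINT x|lebesgue. exp (- 2 * of_real pi * \<i> * of_real (x \<bullet> \<xi>)) * f x)"

text \<open>
  The continuous extension of the Fourier transform from \<open>L\<^sup>1 \<inter> L\<^sup>p\<close> to \<open>L\<^sup>p\<close>, with values in
  \<open>L\<^sup>q\<close>, \<open>q = p / (p - 1)\<close>: off \<open>L\<^sup>1\<close>, the transform of \<open>f\<close> is the \<open>L\<^sup>q\<close>-limit of the transforms
  of functions in \<open>L\<^sup>1 \<inter> L\<^sup>p\<close> that approximate \<open>f\<close> in \<open>L\<^sup>p\<close>. For \<open>1 < p < 2\<close> the Hausdorff-Young
  inequality says that this limit exists and, up to null sets, does not depend on the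
  approximating sequence; the choice operator only selects a representative.
\<close>

definition is_fourier_limit ::
    "real \<Rightarrow> (real^'d::finite \<Rightarrow> complex) \<Rightarrow> (real^'d \<Rightarrow> complex) \<Rightarrow> bool" where
  "is_fourier_limit p f g \<longleftrightarrow>
     g \<in> Lp_fun (conj_exp p) \<and>
     (\<exists>F :: nat \<Rightarrow> real^'d \<Rightarrow> complex.
        (\<forall>n. integrable lebesgue (F n) \<and> F n \<in> Lp_fun p) \<and>
        (\<lambda>n. Lp_norm p (\<lambda>x. F n x - f x)) \<longlonglongrightarrow> 0 \<and>
        (\<lambda>n. Lp_norm (conj_exp p) (\<lambda>\<xi>. fourier_integral (F n) \<xi> - g \<xi>)) \<longlonglongrightarrow> 0)"

definition fourier :: "real \<Rightarrow> (real^'d::finite \<Rightarrow> complex) \<Rightarrow> real^'d \<Rightarrow> complex" where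
  "fourier p f =
     (if integrable lebesgue f then fourier_integral f else (SOME g. is_fourier_limit p f g))"

definition B_const :: "'d::finite itself \<Rightarrow> real \<Rightarrow> ennreal" where
  "B_const (_ :: 'd itself) q =
     (SUP E \<in> {E :: (real^'d) set. E \<in> sets lebesgue \<and>
                 0 < emeasure lebesgue E \<and> emeasure lebesgue E < \<infinity>}.
      SUP f \<in> {f :: real^'d \<Rightarrow> complex. f \<in> borel_measurable lebesgue \<and>
                 (\<forall>x. cmod (f x) \<le> indicator E x)}.
        Lp_norm q (fourier (conj_exp q) f) /
        ennreal_powr (emeasure lebesgue E) (1 / conj_exp q))"

text \<open>
  Finite representations are covered by taking \<open>a n = 0\<close> for large \<open>n\<close>. The pointwise identity
  is between extended reals, so it forces convergence of the series almost everywhere. The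
  infimum is \<open>\<infinity>\<close> if there is no representation with finite coefficient sum.
\<close>

definition L_norm :: "real \<Rightarrow> (real^'d::finite \<Rightarrow> complex) \<Rightarrow> ennreal" where
  "L_norm p f = Inf {\<Sum>n. ennreal (a n) | (a :: nat \<Rightarrow> real) (E :: nat \<Rightarrow> (real^'d) set).
     (\<forall>n. 0 \<le> a n) \<and>
     (\<forall>n. E n \<in> sets lebesgue \<and>
          0 < emeasure lebesgue (E n) \<and> emeasure lebesgue (E n) < \<infinity>) \<and>
     (AE x in lebesgue. ennreal (cmod (f x)) =
        (\<Sum>n. ennreal (a n * measure lebesgue (E n) powr (- 1 / p) * indicator (E n) x)))}"

end

theory Submission
  imports Defs
begin

text \<open>
  Write \<open>B\<close> for the constant and \<open>L\<close> for the atomic norm. The two suprema are compared separately.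

  \<^emph>\<open>The constant is at most the supremum of the ratios.\<close> If \<open>\<bar>f\<bar> \<le> 1\<^sub>E\<close>, the binary digits of
  the values of \<open>\<bar>f\<bar>\<close> write \<open>\<bar>f\<bar>\<close> as \<open>\<Sum>k. 2\<^sup>-\<^sup>k 1\<^sub>A\<close> with sets \<open>A = A k \<subseteq> E\<close>, \<open>k \<ge> 1\<close>, and this
  representation costs at most \<open>\<Sum>k. 2\<^sup>-\<^sup>k \<bar>E\<bar>\<^bsup>1/p\<^esup> = \<bar>E\<bar>\<^bsup>1/p\<^esup>\<close>. So \<open>L f \<le> \<bar>E\<bar>\<^bsup>1/p\<^esup>\<close>
  (\<open>L_norm_indicator_bound\<close>), and the ratio of \<open>f\<close> is at least the quotient in the definition of \<open>B\<close>.

  \<^emph>\<open>Every ratio is at most the constant.\<close> Let \<open>B < \<infinity>\<close> and let \<open>\<bar>f\<bar> = \<Sum>n. a n \<bar>E n\<bar>\<^bsup>-1/p\<^esup> 1\<close>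
  with indicators of the \<open>E n\<close>. Multiplying by the sign of \<open>f\<close> splits \<open>f\<close> into pieces, and by the
  definition of \<open>B\<close> the transform of the \<open>n\<close>-th piece has \<open>L\<^sup>q\<close> norm at most \<open>a n B\<close>. By the
  countable Minkowski inequality (\<open>Lp_norm_suminf\<close>) the sum of the transforms converges absolutely
  a.e. to a function of \<open>L\<^sup>q\<close> norm at most \<open>B \<Sum>n. a n\<close>. It remains to identify this function with
  the transform of \<open>f\<close>. For integrable \<open>f\<close> this is dominated convergence in the Fourier integral.
  Otherwise the partial sums show that the limit function satisfies \<open>is_fourier_limit\<close>, and one
  needs that \<open>is_fourier_limit\<close> determines its function a.e., since the transform is chosen by
  Hilbert choice.

  This uniqueness (\<open>is_fourier_limit_unique\<close>) is a closability statement, and \<open>B < \<infinity>\<close> itself yields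
  it by duality: if \<open>D n \<rightarrow> 0\<close> in \<open>L\<^sup>p\<close> and the transforms tend
  to \<open>k\<close> in \<open>L\<^sup>q\<close>, then pairing with a bounded \<open>\<phi>\<close> supported in a ball and moving the transform to
  \<open>\<phi>\<close> gives \<open>\<integral> k \<phi> = 0\<close>, because the transform of \<open>\<phi>\<close> lies in \<open>L\<^sup>q\<close> when \<open>B < \<infinity>\<close>. The choice
  \<open>\<phi> = cnj (sgn k) 1\<close> on the ball yields \<open>k = 0\<close> there.
\<close>

section \<open>Lebesgue norms: Minkowski and Hoelder inequalities\<close>

lemma ennreal_powr_mono:
  assumes "0 < s" "t \<le> t'"
  shows "ennreal_powr t s \<le> ennreal_powr t' s"
  using assms unfolding ennreal_powr_def
  by (cases t; cases t') (auto intro!: ennreal_leI powr_mono2 simp: top_unique)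

text \<open>
  Bounds by a finite constant are turned into bounds for the integral of the power, where linearity and
  the convergence theorems apply.
\<close>

lemma Lp_norm_le_iff:
  assumes "0 < r" "0 \<le> c"
  shows "Lp_norm r f \<le> ennreal c \<longleftrightarrow>
    (\<integral>\<^sup>+ x. ennreal (cmod (f x) powr r) \<partial>lebesgue) \<le> ennreal (c powr r)"
proof (cases "\<integral>\<^sup>+ x. ennreal (cmod (f x) powr r) \<partial>lebesgue")
  case (real t)
  have "t powr (1/r) \<le> c \<longleftrightarrow> t \<le> c powr r"
    using assms real(1) powr_mono2[of r "t powr (1/r)" c] powr_mono2[of "1/r" t "c powr r"]
    by (auto simp: powr_powr)
  then show ?thesis
    using real assms by (simp add: Lp_norm_def ennreal_powr_def)
next
  case top
  then show ?thesis by (simp add: Lp_norm_def ennreal_powr_def top_unique)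
qed

lemma Lp_norm_mono_AE:
  assumes "0 < r" "AE x in lebesgue. cmod (f x) \<le> cmod (g x)"
  shows "Lp_norm r f \<le> Lp_norm r g"
  unfolding Lp_norm_def
  by (intro ennreal_powr_mono nn_integral_mono_AE, use assms in simp,
      use assms in \<open>auto intro: ennreal_leI powr_mono2 elim!: eventually_mono\<close>)

lemma Lp_norm_cong_AE:
  assumes "0 < r" "AE x in lebesgue. cmod (f x) = cmod (g x)"
  shows "Lp_norm r f = Lp_norm r g"
  using assms by (intro antisym Lp_norm_mono_AE) (auto elim!: eventually_mono)

lemma Lp_norm_zero:
  "Lp_norm r (\<lambda>x. 0) = 0"
  by (simp add: Lp_norm_def ennreal_powr_def)

lemma Lp_norm_eq_0_imp_AE:
  assumes "0 < r" and [measurable]: "f \<in> borel_measurable lebesgue" and "Lp_norm r f = 0"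
  shows "AE x in lebesgue. f x = 0"
proof -
  have "(\<integral>\<^sup>+ x. ennreal (cmod (f x) powr r) \<partial>lebesgue) = 0"
    using Lp_norm_le_iff[of r 0 f] assms by simp
  then have "AE x in lebesgue. ennreal (cmod (f x) powr r) = 0"
    by (subst (asm) nn_integral_0_iff_AE) auto
  then show ?thesis
    by eventually_elim (simp add: ennreal_eq_0_iff)
qed

lemma Lp_norm_cmult:
  assumes "0 < r" "f \<in> borel_measurable lebesgue"
  shows "Lp_norm r (\<lambda>x. c * f x) = ennreal (cmod c) * Lp_norm r f"
proof (cases "c = 0")
  case True
  then show ?thesis by (simp add: Lp_norm_zero)
next
  case False
  have [measurable]: "f \<in> borel_measurable lebesgue" by fact
  have *: "(\<integral>\<^sup>+ x. ennreal (cmod (c * f x) powr r) \<partial>lebesgue) =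
      ennreal (cmod c powr r) * (\<integral>\<^sup>+ x. ennreal (cmod (f x) powr r) \<partial>lebesgue)"
    by (subst nn_integral_cmult[symmetric])
       (auto simp: norm_mult powr_mult ennreal_mult intro!: nn_integral_cong)
  show ?thesis
    unfolding Lp_norm_def * ennreal_powr_def
    using False assms(1)
    by (cases "\<integral>\<^sup>+ x. ennreal (cmod (f x) powr r) \<partial>lebesgue")
       (auto simp: ennreal_mult_top ennreal_mult_eq_top_iff enn2real_mult powr_mult powr_powr
          ennreal_mult[symmetric])
qed

text \<open>
  Convexity of the power function on the closed half line. If \<open>u\<close> or \<open>v\<close> vanishes, this reduces to
  \<open>l powr r \<le> l\<close> for \<open>l \<in> {0<..<1}\<close>.
\<close>

lemma powr_convex_combination:
  fixes u v l m r :: real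
  assumes "1 \<le> r" "0 \<le> u" "0 \<le> v" "0 < l" "0 < m" "l + m = 1"
  shows "(l * u + m * v) powr r \<le> l * u powr r + m * v powr r"
proof -
  have scale: "(k * w) powr r \<le> k * w powr r" if "0 < k" "k < 1" "0 \<le> w" for k w :: real
  proof -
    have "k powr r \<le> k" using powr_mono'[of 1 r k] that assms(1) by simp
    then show ?thesis using that by (simp add: powr_mult mult_right_mono)
  qed
  show ?thesis
  proof (cases "u = 0 \<or> v = 0")
    case True
    then show ?thesis using scale[of m v] scale[of l u] assms by auto
  next
    case False
    then show ?thesis
      using convex_onD[OF powr_convex[OF assms(1)], of m u v] assms
      by (auto simp: eq_diff_eq[symmetric] less_le)
  qed
qed

text \<open>
  Minkowski's inequality. With norms \<open>a, b > 0\<close>, the normalised sum is the convex combination of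
  \<open>\<bar>u\<bar> / a\<close> and \<open>\<bar>v\<bar> / b\<close> with weights \<open>a / (a + b)\<close> and \<open>b / (a + b)\<close>, so convexity of the power
  function bounds the integral of its \<open>r\<close>-th power by 1.
\<close>

lemma Lp_norm_triangle:
  assumes "1 \<le> r" and [measurable]: "u \<in> borel_measurable lebesgue" "v \<in> borel_measurable lebesgue"
  shows "Lp_norm r (\<lambda>x. u x + v x) \<le> Lp_norm r u + Lp_norm r v"
proof -
  have r: "0 < r" using assms(1) by simp
  consider "Lp_norm r u = \<infinity> \<or> Lp_norm r v = \<infinity>" | "Lp_norm r u = 0" | "Lp_norm r v = 0"
    | a b where "Lp_norm r u = ennreal a" "Lp_norm r v = ennreal b" "0 < a" "0 < b"
    by (cases "Lp_norm r u"; cases "Lp_norm r v") (auto simp: less_le)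
  then show ?thesis
  proof cases
    case 1
    then show ?thesis by auto
  next
    case 2
    have "AE x in lebesgue. cmod (u x + v x) = cmod (v x)"
      using Lp_norm_eq_0_imp_AE[OF r _ 2] by (auto elim!: eventually_mono)
    from Lp_norm_cong_AE[OF r this] show ?thesis by simp
  next
    case 3
    have "AE x in lebesgue. cmod (u x + v x) = cmod (u x)"
      using Lp_norm_eq_0_imp_AE[OF r _ 3] by (auto elim!: eventually_mono)
    from Lp_norm_cong_AE[OF r this] show ?thesis by simp
  next
    case 4
    define l m where "l = a / (a + b)" and "m = b / (a + b)"
    have lm: "0 < l" "0 < m" "l + m = 1"
      using 4 by (auto simp: l_def m_def add_divide_distrib[symmetric])
    have sc: "(a + b) powr r * (l * (s / a) powr r) = (a + b) powr r * l / a powr r * s powr r"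
      "(a + b) powr r * (m * (s / b) powr r) = (a + b) powr r * m / b powr r * s powr r"
      if "0 \<le> s" for s
      using that 4 by (auto simp: powr_divide)
    have pw: "cmod (u x + v x) powr r \<le>
       (a + b) powr r * l / a powr r * cmod (u x) powr r + (a + b) powr r * m / b powr r * cmod (v x) powr r" for x
    proof -
      have "(a + b) * (l * (cmod (u x) / a)) = cmod (u x)" "(a + b) * (m * (cmod (v x) / b)) = cmod (v x)"
        using 4 by (auto simp: l_def m_def)
      then have "cmod (u x + v x) \<le> (a + b) * (l * (cmod (u x) / a) + m * (cmod (v x) / b))"
        using norm_triangle_ineq[of "u x" "v x"] by (simp only: distrib_left)
      then have "cmod (u x + v x) powr r \<le> ((a + b) * (l * (cmod (u x) / a) + m * (cmod (v x) / b))) powr r"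
        using r by (intro powr_mono2) auto
      also have "\<dots> = (a + b) powr r * (l * (cmod (u x) / a) + m * (cmod (v x) / b)) powr r"
        using 4 lm by (intro powr_mult) 
      also have "\<dots> \<le> (a + b) powr r * (l * (cmod (u x) / a) powr r + m * (cmod (v x) / b) powr r)"
        using 4 lm by (intro mult_left_mono powr_convex_combination assms) auto
      finally show ?thesis by (simp add: distrib_left sc)
    qed
    have U: "(\<integral>\<^sup>+ x. ennreal (cmod (u x) powr r) \<partial>lebesgue) \<le> ennreal (a powr r)"
      using Lp_norm_le_iff[OF r, of a u] 4 by simp
    have V: "(\<integral>\<^sup>+ x. ennreal (cmod (v x) powr r) \<partial>lebesgue) \<le> ennreal (b powr r)"
      using Lp_norm_le_iff[OF r, of b v] 4 by simp
    define cu cv where "cu = (a + b) powr r * l / a powr r" and "cv = (a + b) powr r * m / b powr r"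
    have c: "0 \<le> cu" "0 \<le> cv" using lm by (auto simp: cu_def cv_def)
    have "(\<integral>\<^sup>+ x. ennreal (cmod (u x + v x) powr r) \<partial>lebesgue) \<le>
      (\<integral>\<^sup>+ x. ennreal cu * ennreal (cmod (u x) powr r) + ennreal cv * ennreal (cmod (v x) powr r) \<partial>lebesgue)"
      using c pw unfolding cu_def[symmetric] cv_def[symmetric]
      by (intro nn_integral_mono) (simp add: ennreal_mult[symmetric] ennreal_plus[symmetric] ennreal_leI del: ennreal_plus)
    also have "\<dots> = ennreal cu * (\<integral>\<^sup>+ x. ennreal (cmod (u x) powr r) \<partial>lebesgue)
        + ennreal cv * (\<integral>\<^sup>+ x. ennreal (cmod (v x) powr r) \<partial>lebesgue)"
      by (subst nn_integral_add) (auto simp: nn_integral_cmult)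
    also have "\<dots> \<le> ennreal cu * ennreal (a powr r) + ennreal cv * ennreal (b powr r)"
      by (intro add_mono mult_left_mono U V) auto
    also have "\<dots> = ennreal (cu * a powr r + cv * b powr r)"
      using c by (simp add: ennreal_mult)
    also have "cu * a powr r + cv * b powr r = (a + b) powr r * (l + m)"
      using 4 by (simp add: cu_def cv_def algebra_simps)
    finally have "Lp_norm r (\<lambda>x. u x + v x) \<le> ennreal (a + b)"
      using lm 4 by (subst Lp_norm_le_iff[OF r]) auto
    then show ?thesis using 4 by simp
  qed
qed

lemma Lp_norm_sum_cmod:
  fixes u :: "nat \<Rightarrow> real^'d::finite \<Rightarrow> complex"
  assumes "1 \<le> r" and [measurable]: "\<And>n. u n \<in> borel_measurable lebesgue"
  shows "Lp_norm r (\<lambda>x. complex_of_real (\<Sum>n<N. cmod (u n x))) \<le> (\<Sum>n<N. Lp_norm r (u n))"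
proof (induction N)
  case 0
  then show ?case by (simp add: Lp_norm_zero)
next
  case (Suc N)
  have "Lp_norm r (\<lambda>x. complex_of_real (\<Sum>n<Suc N. cmod (u n x))) \<le>
    Lp_norm r (\<lambda>x. complex_of_real (\<Sum>n<N. cmod (u n x))) + Lp_norm r (\<lambda>x. complex_of_real (cmod (u N x)))"
    using Lp_norm_triangle[OF assms(1), of "\<lambda>x. complex_of_real (\<Sum>n<N. cmod (u n x))" "\<lambda>x. complex_of_real (cmod (u N x))"]
    by simp
  also have "Lp_norm r (\<lambda>x. complex_of_real (cmod (u N x))) = Lp_norm r (u N)"
    using assms(1) by (intro Lp_norm_cong_AE) auto
  finally show ?case using Suc by (auto intro: order_trans add_right_mono)
qed

text \<open>
  The countable Minkowski inequality: the powers of the partial sums increase, and their integrals are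
  bounded by the finite version, so monotone convergence shows that their supremum is integrable, hence
  finite a.e. The resulting sum of moduli is the dominating function for limits of partial sums.
\<close>

lemma Lp_norm_suminf:
  fixes u :: "nat \<Rightarrow> real^'d::finite \<Rightarrow> complex"
  assumes r: "1 \<le> r" and [measurable]: "\<And>n. u n \<in> borel_measurable lebesgue"
    and fin: "(\<Sum>n. Lp_norm r (u n)) < \<infinity>"
  shows "AE x in lebesgue. summable (\<lambda>n. cmod (u n x))"
    and "Lp_norm r (\<lambda>x. complex_of_real (\<Sum>n. cmod (u n x))) \<le> (\<Sum>n. Lp_norm r (u n))"
proof -
  obtain C where C: "(\<Sum>n. Lp_norm r (u n)) = ennreal C" "0 \<le> C"
    using fin by (cases "\<Sum>n. Lp_norm r (u n)") auto
  define w where "w N x = (\<Sum>n<N. cmod (u n x)) powr r" for N x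
  have [measurable]: "w N \<in> borel_measurable lebesgue" for N
    unfolding w_def by measurable
  have mono: "w M x \<le> w N x" if "M \<le> N" for M N x
    unfolding w_def using that r
    by (intro powr_mono2 sum_mono2 sum_nonneg) auto
  have bd: "(\<integral>\<^sup>+ x. ennreal (w N x) \<partial>lebesgue) \<le> ennreal (C powr r)" for N
  proof -
    have "Lp_norm r (\<lambda>x. complex_of_real (\<Sum>n<N. cmod (u n x))) \<le> ennreal C"
      unfolding C(1)[symmetric] 
      by (rule order_trans[OF Lp_norm_sum_cmod[OF r]]) (auto intro: sum_le_suminf)
    then show ?thesis
      using r C by (subst (asm) Lp_norm_le_iff) (auto simp: w_def sum_nonneg simp del: of_real_sum)
  qed
  have eq: "(\<integral>\<^sup>+ x. (SUP N. ennreal (w N x)) \<partial>lebesgue) = (SUP N. \<integral>\<^sup>+ x. ennreal (w N x) \<partial>lebesgue)"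
    by (intro nn_integral_monotone_convergence_SUP)
       (auto simp: incseq_def le_fun_def intro!: ennreal_leI mono)
  then have sup_le: "(\<integral>\<^sup>+ x. (SUP N. ennreal (w N x)) \<partial>lebesgue) \<le> ennreal (C powr r)"
    using bd by (auto intro: SUP_least)
  then have "AE x in lebesgue. (SUP N. ennreal (w N x)) \<noteq> \<infinity>"
    by (intro nn_integral_PInf_AE) (auto simp: top_unique)
  then have key: "AE x in lebesgue. summable (\<lambda>n. cmod (u n x)) \<and>
      ennreal (cmod (complex_of_real (\<Sum>n. cmod (u n x))) powr r) \<le> (SUP N. ennreal (w N x))"
  proof eventually_elim
    case (elim x)
    then obtain K where K: "(SUP N. ennreal (w N x)) = ennreal K" "0 \<le> K"
      by (cases "SUP N. ennreal (w N x)") auto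
    have wK: "w N x \<le> K" for N
      using SUP_upper[of N UNIV "\<lambda>N. ennreal (w N x)"] K by simp
    have "(\<Sum>n<N. cmod (u n x)) \<le> K powr (1/r)" for N
    proof -
      have "(w N x) powr (1/r) \<le> K powr (1/r)"
        using wK r by (intro powr_mono2) (auto simp: w_def)
      then show ?thesis using r by (simp add: w_def powr_powr sum_nonneg)
    qed
    then have s: "summable (\<lambda>n. cmod (u n x))"
      by (intro bounded_imp_summable[of _ "K powr (1/r)"]) (auto simp only: lessThan_Suc_atMost[symmetric] norm_ge_zero)
    have "(\<lambda>N. w N x) \<longlonglongrightarrow> (\<Sum>n. cmod (u n x)) powr r"
      unfolding w_def using r summable_LIMSEQ[OF s]
      by (intro tendsto_powr' tendsto_const) (auto intro!: always_eventually sum_nonneg)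
    then have "(\<Sum>n. cmod (u n x)) powr r \<le> K"
      using wK by (intro LIMSEQ_le_const2) auto
    then show ?case using s K by (auto simp: suminf_nonneg intro: ennreal_leI)
  qed
  then show "AE x in lebesgue. summable (\<lambda>n. cmod (u n x))" by (rule eventually_mono) simp
  have "(\<integral>\<^sup>+ x. ennreal (cmod (complex_of_real (\<Sum>n. cmod (u n x))) powr r) \<partial>lebesgue)
      \<le> (\<integral>\<^sup>+ x. (SUP N. ennreal (w N x)) \<partial>lebesgue)"
    using key by (intro nn_integral_mono_AE) (auto elim: eventually_mono)
  also note sup_le
  finally show "Lp_norm r (\<lambda>x. complex_of_real (\<Sum>n. cmod (u n x))) \<le> (\<Sum>n. Lp_norm r (u n))"
    using r C by (subst C(1), subst Lp_norm_le_iff) auto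
qed

text \<open>
  Young's inequality applied to \<open>\<bar>u\<bar> / a\<close> and \<open>\<bar>v\<bar> / b\<close>, where \<open>a\<close> and \<open>b\<close> are the norms, gives after
  multiplication by \<open>a b\<close> a pointwise bound whose integral is \<open>a b (1/p + 1/q) = a b\<close>.
\<close>

lemma Holder_Lp_norm:
  fixes u v :: "real^'d::finite \<Rightarrow> complex"
  assumes p: "1 < p" and q: "1 < q" and pq: "1/p + 1/q = 1"
    and [measurable]: "u \<in> borel_measurable lebesgue" "v \<in> borel_measurable lebesgue"
  shows "(\<integral>\<^sup>+ x. ennreal (cmod (u x * v x)) \<partial>lebesgue) \<le> Lp_norm p u * Lp_norm q v"
proof -
  consider "Lp_norm p u = 0 \<or> Lp_norm q v = 0" | "Lp_norm p u \<noteq> 0" "Lp_norm q v \<noteq> 0" "Lp_norm p u = \<infinity> \<or> Lp_norm q v = \<infinity>"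
    | a b where "Lp_norm p u = ennreal a" "Lp_norm q v = ennreal b" "0 < a" "0 < b"
    by (cases "Lp_norm p u"; cases "Lp_norm q v") (auto simp: less_le)
  then show ?thesis
  proof cases
    case 1
    then have "AE x in lebesgue. u x * v x = 0"
      using Lp_norm_eq_0_imp_AE[of p u] Lp_norm_eq_0_imp_AE[of q v] p q
      by (auto elim!: eventually_mono)
    then have "(\<integral>\<^sup>+ x. ennreal (cmod (u x * v x)) \<partial>lebesgue) = 0"
      by (subst nn_integral_0_iff_AE) (auto elim: eventually_mono)
    then show ?thesis by simp
  next
    case 2
    then show ?thesis by (auto simp: ennreal_mult_eq_top_iff)
  next
    case 3
    have U: "(\<integral>\<^sup>+ x. ennreal (cmod (u x) powr p) \<partial>lebesgue) \<le> ennreal (a powr p)"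
      using Lp_norm_le_iff[of p a u] 3 p by simp
    have V: "(\<integral>\<^sup>+ x. ennreal (cmod (v x) powr q) \<partial>lebesgue) \<le> ennreal (b powr q)"
      using Lp_norm_le_iff[of q b v] 3 q by simp
    define cu cv where "cu = a * b / (p * a powr p)" and "cv = a * b / (q * b powr q)"
    have c: "0 \<le> cu" "0 \<le> cv" using 3 p q by (auto simp: cu_def cv_def)
    have pw: "cmod (u x * v x) \<le> cu * cmod (u x) powr p + cv * cmod (v x) powr q" for x
    proof -
      have "(cmod (u x) / a) * (cmod (v x) / b) \<le> (cmod (u x) / a) powr p / p + (cmod (v x) / b) powr q / q"
        using 3 p q pq by (intro Youngs_inequality) auto
      also have "\<dots> = (cmod (u x) powr p / a powr p) / p + (cmod (v x) powr q / b powr q) / q"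
        using 3 by (simp add: powr_divide)
      finally have "a * b * ((cmod (u x) / a) * (cmod (v x) / b)) \<le>
         a * b * ((cmod (u x) powr p / a powr p) / p + (cmod (v x) powr q / b powr q) / q)"
        using 3 by (intro mult_left_mono) auto
      then show ?thesis using 3 by (simp add: norm_mult cu_def cv_def algebra_simps)
    qed
    have "(\<integral>\<^sup>+ x. ennreal (cmod (u x * v x)) \<partial>lebesgue) \<le>
      (\<integral>\<^sup>+ x. ennreal cu * ennreal (cmod (u x) powr p) + ennreal cv * ennreal (cmod (v x) powr q) \<partial>lebesgue)"
      using c pw
      by (intro nn_integral_mono) (simp add: ennreal_mult[symmetric] ennreal_plus[symmetric] ennreal_leI del: ennreal_plus)
    also have "\<dots> = ennreal cu * (\<integral>\<^sup>+ x. ennreal (cmod (u x) powr p) \<partial>lebesgue)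
        + ennreal cv * (\<integral>\<^sup>+ x. ennreal (cmod (v x) powr q) \<partial>lebesgue)"
      by (subst nn_integral_add) (auto simp: nn_integral_cmult)
    also have "\<dots> \<le> ennreal cu * ennreal (a powr p) + ennreal cv * ennreal (b powr q)"
      by (intro add_mono mult_left_mono U V) auto
    also have "\<dots> = ennreal (cu * a powr p + cv * b powr q)"
      using c by (simp add: ennreal_mult)
    also have "cu * a powr p + cv * b powr q = a * b * (1/p + 1/q)"
      using 3 by (simp add: cu_def cv_def algebra_simps)
    finally show ?thesis using 3 pq by (simp add: ennreal_mult)
  qed
qed

lemma Lp_norm_dominated_convergence:
  fixes u :: "nat \<Rightarrow> real^'d::finite \<Rightarrow> complex"
  assumes r: "0 < r" and [measurable]: "\<And>n. u n \<in> borel_measurable lebesgue"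
    "w \<in> borel_measurable lebesgue"
    and w: "Lp_norm r w < \<infinity>"
    and bd: "\<And>n. AE x in lebesgue. cmod (u n x) \<le> cmod (w x)"
    and lim: "AE x in lebesgue. (\<lambda>n. u n x) \<longlonglongrightarrow> 0"
  shows "(\<lambda>n. Lp_norm r (u n)) \<longlonglongrightarrow> 0"
proof -
  have "(\<integral>\<^sup>+ x. ennreal (cmod (w x) powr r) \<partial>lebesgue) < \<infinity>"
    using w by (auto simp: Lp_norm_def ennreal_powr_def less_top split: if_splits)
  then have "(\<lambda>n. \<integral>\<^sup>+ x. ennreal (cmod (u n x) powr r) \<partial>lebesgue) \<longlonglongrightarrow> (\<integral>\<^sup>+ x. 0 \<partial>(lebesgue :: (real^'d) measure))"
  proof (rule nn_integral_dominated_convergence[rotated 4])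
    show "AE x in lebesgue. (\<lambda>n. ennreal (cmod (u n x) powr r)) \<longlonglongrightarrow> 0"
      using lim
    proof eventually_elim
      case (elim x)
      have "(\<lambda>n. cmod (u n x) powr r) \<longlonglongrightarrow> 0 powr r"
        using r tendsto_norm_zero[OF elim] by (intro tendsto_powr' tendsto_const) auto
      then show ?case using tendsto_ennrealI by fastforce
    qed
    show "AE x in lebesgue. ennreal (cmod (u n x) powr r) \<le> ennreal (cmod (w x) powr r)" for n
      using bd[of n] r by (auto intro!: ennreal_leI powr_mono2 elim!: eventually_mono)
  qed auto
  then have lim0: "(\<lambda>n. \<integral>\<^sup>+ x. ennreal (cmod (u n x) powr r) \<partial>lebesgue) \<longlonglongrightarrow> 0" by simp
  show ?thesis
  proof (rule order_tendstoI)
    fix e :: ennreal assume "0 < e"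
    then obtain c where c: "0 < c" "ennreal c < e"
      by (metis ennreal_rat_dense ennreal_less_zero_iff)
    have "eventually (\<lambda>n. (\<integral>\<^sup>+ x. ennreal (cmod (u n x) powr r) \<partial>lebesgue) < ennreal (c powr r)) sequentially"
      using order_tendstoD(2)[OF lim0, of "ennreal (c powr r)"] c by simp
    then show "eventually (\<lambda>n. Lp_norm r (u n) < e) sequentially"
    proof eventually_elim
      case (elim n)
      then have "Lp_norm r (u n) \<le> ennreal c"
        using c r by (subst Lp_norm_le_iff) auto
      with c show ?case by simp
    qed
  qed auto
qed

lemma Lp_norm_indicator_bound:
  fixes \<phi> :: "real^'d::finite \<Rightarrow> complex"
  assumes r: "0 < r" and "A \<in> sets lebesgue" and "\<And>x. cmod (\<phi> x) \<le> indicator A x"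
  shows "Lp_norm r \<phi> \<le> ennreal_powr (emeasure lebesgue A) (1 / r)"
proof -
  have "(\<integral>\<^sup>+ x. ennreal (cmod (\<phi> x) powr r) \<partial>lebesgue) \<le> (\<integral>\<^sup>+ x. indicator A x \<partial>lebesgue)"
  proof (intro nn_integral_mono)
    fix x
    have "cmod (\<phi> x) powr r \<le> indicator A x powr r"
      using assms by (intro powr_mono2) auto
    then have "ennreal (cmod (\<phi> x) powr r) \<le> ennreal (indicator A x powr r)" by (rule ennreal_leI)
    also have "\<dots> = indicator A x"
      using r by (auto simp: indicator_def)
    finally show "ennreal (cmod (\<phi> x) powr r) \<le> indicator A x" .
  qed
  then show ?thesis
    using assms unfolding Lp_norm_def by (intro ennreal_powr_mono) auto
qed

lemma integrable_indicator_bound: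
  assumes [measurable]: "f \<in> borel_measurable lebesgue" and "A \<in> sets lebesgue" "emeasure lebesgue A < \<infinity>"
    and "\<And>x. cmod (f x) \<le> indicator A x"
  shows "integrable lebesgue f"
proof (rule Bochner_Integration.integrable_bound)
  show "integrable lebesgue (indicator A :: _ \<Rightarrow> real)"
    using assms by (auto simp: integrable_indicator_iff)
qed (use assms in auto)

section \<open>The Fourier integral\<close>

lemma sigma_finite_lebesgue:
  "sigma_finite_measure (lebesgue :: 'a::euclidean_space measure)"
proof
  show "\<exists>A. countable A \<and> A \<subseteq> sets lebesgue \<and> \<Union> A = space (lebesgue :: 'a measure) \<and>
      (\<forall>a\<in>A. emeasure lebesgue a \<noteq> \<infinity>)"
  proof (intro exI[of _ "range (\<lambda>n::nat. ball 0 (real n))"] conjI ballI)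
    show "\<Union> (range (\<lambda>n::nat. ball 0 (real n))) = space (lebesgue :: 'a measure)"
      using reals_Archimedean2 by auto
    show "emeasure lebesgue a \<noteq> \<infinity>" if "a \<in> range (\<lambda>n::nat. ball (0::'a) (real n))" for a
      using that lmeasurable_ball[of 0] by (auto simp: fmeasurable_def less_top)
  qed auto
qed

interpretation lebesgue_pair:
  pair_sigma_finite "lebesgue :: (real^'d::finite) measure" "lebesgue :: (real^'d) measure"
  by (intro pair_sigma_finite.intro sigma_finite_lebesgue)

lemma measurable_ident_lebesgue:
  "(\<lambda>x. x) \<in> borel_measurable (lebesgue :: 'a::euclidean_space measure)"
  by (rule measurable_completion) simp

lemma measurable_fst_lebesgue [measurable]:
  "fst \<in> borel_measurable (lebesgue \<Otimes>\<^sub>M M)" for M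
  by (rule measurable_compose[OF measurable_fst measurable_ident_lebesgue])

lemma measurable_snd_lebesgue [measurable]:
  "snd \<in> borel_measurable (M \<Otimes>\<^sub>M lebesgue)" for M
  by (rule measurable_compose[OF measurable_snd measurable_ident_lebesgue])

definition fourier_kernel :: "real^'d::finite \<Rightarrow> real^'d \<Rightarrow> complex" where
  "fourier_kernel x \<xi> = exp (- 2 * of_real pi * \<i> * of_real (x \<bullet> \<xi>))"

lemma norm_fourier_kernel [simp]: "cmod (fourier_kernel x \<xi>) = 1"
  unfolding fourier_kernel_def by simp

lemma fourier_kernel_commute: "fourier_kernel x \<xi> = fourier_kernel \<xi> x"
  by (simp add: fourier_kernel_def inner_commute)

lemma fourier_integral_eq: "fourier_integral f \<xi> = (LINT x|lebesgue. fourier_kernel x \<xi> * f x)"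
  by (simp add: fourier_integral_def fourier_kernel_def)

lemma measurable_fourier_kernel [measurable]:
  assumes "a \<in> borel_measurable M" "b \<in> borel_measurable M"
  shows "(\<lambda>y. fourier_kernel (a y) (b y)) \<in> borel_measurable M"
  using assms unfolding fourier_kernel_def by measurable

lemma integrable_fourier_kernel_mult:
  assumes "integrable lebesgue f"
  shows "integrable lebesgue (\<lambda>x. fourier_kernel x \<xi> * f x)"
proof (rule Bochner_Integration.integrable_bound[OF assms])
  have [measurable]: "f \<in> borel_measurable lebesgue" using assms by simp
  note measurable_ident_lebesgue [measurable]
  show "(\<lambda>x. fourier_kernel x \<xi> * f x) \<in> borel_measurable lebesgue" by measurable
qed (simp add: norm_mult)

lemma borel_measurable_fourier_integral [measurable]:
  fixes f :: "real^'d::finite \<Rightarrow> complex"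
  assumes [measurable]: "f \<in> borel_measurable lebesgue"
  shows "fourier_integral f \<in> borel_measurable lebesgue"
proof -
  interpret sigma_finite_measure "lebesgue :: (real^'d) measure" by (rule sigma_finite_lebesgue)
  have "(\<lambda>\<xi>. LINT x|lebesgue. fourier_kernel x \<xi> * f x) \<in> borel_measurable lebesgue"
    using measurable_ident_lebesgue [measurable] by measurable
  then show ?thesis by (simp add: fourier_integral_eq[abs_def])
qed

lemma fourier_integral_cmult:
  "fourier_integral (\<lambda>x. c * f x) \<xi> = c * fourier_integral f \<xi>"
  unfolding fourier_integral_eq by (subst integral_mult_right_zero[symmetric]) (simp add: ac_simps)

lemma fourier_integral_sum:
  assumes "\<And>i. i \<in> I \<Longrightarrow> integrable lebesgue (f i)"
  shows "fourier_integral (\<lambda>x. \<Sum>i\<in>I. f i x) \<xi> = (\<Sum>i\<in>I. fourier_integral (f i) \<xi>)"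
  unfolding fourier_integral_eq sum_distrib_left
  by (rule Bochner_Integration.integral_sum) (rule integrable_fourier_kernel_mult[OF assms])

lemma fourier_integral_diff:
  assumes "integrable lebesgue f" "integrable lebesgue g"
  shows "fourier_integral (\<lambda>x. f x - g x) \<xi> = fourier_integral f \<xi> - fourier_integral g \<xi>"
  unfolding fourier_integral_eq right_diff_distrib
  by (intro Bochner_Integration.integral_diff integrable_fourier_kernel_mult assms)

lemma fourier_integral_zero_AE:
  assumes "AE x in lebesgue. f x = 0"
  shows "fourier_integral f \<xi> = 0"
  unfolding fourier_integral_eq
  by (rule integral_eq_zero_AE) (use assms in \<open>auto elim: eventually_mono\<close>)

lemma integrable_fourier_integral_mult:
  assumes f: "integrable lebesgue f" and \<phi>: "integrable lebesgue \<phi>"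
  shows "integrable lebesgue (\<lambda>x. fourier_integral f x * \<phi> x)"
proof -
  have [measurable]: "f \<in> borel_measurable lebesgue" "\<phi> \<in> borel_measurable lebesgue"
    using assms by auto
  show ?thesis
  proof (rule Bochner_Integration.integrable_bound)
    show "integrable lebesgue (\<lambda>x. (LINT y|lebesgue. cmod (f y)) * cmod (\<phi> x))"
      using \<phi> by simp
    have "cmod (fourier_integral f x) \<le> (LINT y|lebesgue. cmod (f y))" for x
      unfolding fourier_integral_eq
      by (rule order_trans[OF integral_norm_bound]) (simp add: norm_mult)
    then show "AE x in lebesgue. norm (fourier_integral f x * \<phi> x) \<le>
        norm ((LINT y|lebesgue. cmod (f y)) * cmod (\<phi> x))"
      by (intro AE_I2) (auto simp: norm_mult intro!: mult_right_mono intro: order_trans abs_ge_self)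
  qed measurable
qed

text \<open>
  Fubini's theorem, together with the symmetry of the kernel, moves the transform from one factor to the
  other.
\<close>

lemma fourier_multiplication_formula:
  fixes f \<phi> :: "real^'d::finite \<Rightarrow> complex"
  assumes f: "integrable lebesgue f" and \<phi>: "integrable lebesgue \<phi>"
  shows "(LINT \<xi>|lebesgue. fourier_integral f \<xi> * \<phi> \<xi>) = (LINT x|lebesgue. f x * fourier_integral \<phi> x)"
proof -
  have [measurable]: "f \<in> borel_measurable lebesgue" "\<phi> \<in> borel_measurable lebesgue"
    using assms by auto
  define h where "h x \<xi> = fourier_kernel x \<xi> * f x * \<phi> \<xi>" for x \<xi>
  have meas: "case_prod h \<in> borel_measurable (lebesgue \<Otimes>\<^sub>M lebesgue)"
    unfolding h_def by measurable
  have "integrable (lebesgue \<Otimes>\<^sub>M lebesgue) (case_prod h)"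
  proof (rule lebesgue_pair.Fubini_integrable[OF meas])
    show "integrable lebesgue (\<lambda>x. LINT y|lebesgue. norm (case (x, y) of (x, y) \<Rightarrow> h x y))"
      using f by (simp add: h_def norm_mult)
    show "AE x in lebesgue. integrable lebesgue (\<lambda>y. case (x, y) of (x, y) \<Rightarrow> h x y)"
    proof (rule AE_I2)
      fix x :: "real^'d"
      have "integrable lebesgue (\<lambda>y. f x * (fourier_kernel y x * \<phi> y))"
        by (intro integrable_mult_right integrable_fourier_kernel_mult \<phi>)
      then show "integrable lebesgue (\<lambda>y. case (x, y) of (x, y) \<Rightarrow> h x y)"
        by (simp add: h_def fourier_kernel_commute[of x] ac_simps)
    qed
  qed
  from lebesgue_pair.Fubini_integral[OF this]
  have "(LINT \<xi>|lebesgue. LINT x|lebesgue. h x \<xi>) = (LINT x|lebesgue. LINT \<xi>|lebesgue. h x \<xi>)" .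
  moreover have "(LINT x|lebesgue. h x \<xi>) = fourier_integral f \<xi> * \<phi> \<xi>" for \<xi>
    unfolding fourier_integral_eq h_def by simp
  moreover have "(LINT \<xi>|lebesgue. h x \<xi>) = f x * fourier_integral \<phi> x" for x
  proof -
    have "(LINT \<xi>|lebesgue. h x \<xi>) = (LINT \<xi>|lebesgue. f x * (fourier_kernel \<xi> x * \<phi> \<xi>))"
      by (simp add: h_def fourier_kernel_commute[of x] ac_simps)
    then show ?thesis by (simp add: fourier_integral_eq)
  qed
  ultimately show ?thesis by simp
qed

section \<open>Uniqueness of the Fourier limit\<close>

text \<open>
  The transform is closable as a map from \<open>L\<^sup>p\<close> to \<open>L\<^sup>q\<close> as soon as it maps bounded functions supported
  in balls into \<open>L\<^sup>q\<close> (hypothesis \<open>dual\<close>). Pairing \<open>k\<close> with \<open>\<phi> = cnj (sgn k) 1\<close> on a ball gives the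
  integral of \<open>\<bar>k\<bar>\<close> over the ball. It splits into the pairing of \<open>\<phi>\<close> with \<open>k\<close> minus the transform of
  \<open>D n\<close>, and the pairing of \<open>D n\<close> with the transform of \<open>\<phi>\<close>. By Hoelder's inequality both tend to 0.
\<close>

lemma fourier_limit_zero:
  fixes D :: "nat \<Rightarrow> real^'d::finite \<Rightarrow> complex"
  assumes p: "1 < p" and q: "1 < q" and pq: "1/p + 1/q = 1"
    and D: "\<And>n. integrable lebesgue (D n)"
    and Dlim: "(\<lambda>n. Lp_norm p (D n)) \<longlonglongrightarrow> 0"
    and k [measurable]: "k \<in> borel_measurable lebesgue"
    and klim: "(\<lambda>n. Lp_norm q (\<lambda>\<xi>. fourier_integral (D n) \<xi> - k \<xi>)) \<longlonglongrightarrow> 0"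
    and dual: "\<And>R \<phi> :: real^'d \<Rightarrow> complex. \<phi> \<in> borel_measurable lebesgue \<Longrightarrow> (\<And>x. cmod (\<phi> x) \<le> indicator (ball 0 R) x) \<Longrightarrow>
        Lp_norm q (fourier_integral \<phi>) < \<infinity>"
  shows "AE x in lebesgue. k x = 0"
proof -
  have [measurable]: "D n \<in> borel_measurable lebesgue" for n using D by auto
  have ball_zero: "AE x in lebesgue. x \<in> ball 0 R \<longrightarrow> k x = 0" for R :: real
  proof -
    define \<phi> where "\<phi> x = cnj (sgn (k x)) * indicator (ball 0 R) x" for x
    have \<phi>_meas [measurable]: "\<phi> \<in> borel_measurable lebesgue"
    proof -
      have [measurable]: "(\<lambda>x. cnj (k x)) \<in> borel_measurable lebesgue"
        by (rule borel_measurable_continuous_on[OF _ k]) (intro continuous_intros)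
      have [measurable]: "ball 0 R \<in> sets (lebesgue :: (real^'d) measure)" by simp
      show ?thesis unfolding \<phi>_def sgn_eq complex_cnj_divide complex_cnj_complex_of_real by measurable
    qed
    have \<phi>_bd: "cmod (\<phi> x) \<le> indicator (ball 0 R) x" for x
      by (auto simp: \<phi>_def norm_mult norm_sgn indicator_def)
    have ball_fin: "emeasure lebesgue (ball (0::real^'d) R) < \<infinity>"
      using lmeasurable_ball[of "0::real^'d" R] by (simp add: fmeasurable_def)
    have \<phi>_int: "integrable lebesgue \<phi>"
      by (rule integrable_indicator_bound[OF \<phi>_meas _ ball_fin \<phi>_bd]) auto
    have k\<phi>: "k x * \<phi> x = complex_of_real (cmod (k x) * indicator (ball 0 R) x)" for x
      by (auto simp: \<phi>_def sgn_eq indicator_def complex_norm_square[symmetric] power2_eq_square)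
    have \<phi>_fin: "Lp_norm p \<phi> < \<infinity>"
    proof (rule le_less_trans)
      show "Lp_norm p \<phi> \<le> ennreal_powr (emeasure lebesgue (ball (0::real^'d) R)) (1 / p)"
        using p \<phi>_bd by (intro Lp_norm_indicator_bound) auto
    qed (use ball_fin in \<open>simp add: ennreal_powr_def\<close>)
    define e where "e n = Lp_norm q (\<lambda>\<xi>. fourier_integral (D n) \<xi> - k \<xi>) * Lp_norm p \<phi>
        + Lp_norm p (D n) * Lp_norm q (fourier_integral \<phi>)" for n
    have bound: "(\<integral>\<^sup>+ x. ennreal (cmod (k x * \<phi> x)) \<partial>lebesgue) \<le> e n"
      if "Lp_norm q (\<lambda>\<xi>. fourier_integral (D n) \<xi> - k \<xi>) < 1" for n
    proof -
      have H: "(\<integral>\<^sup>+ x. ennreal (cmod ((fourier_integral (D n) x - k x) * \<phi> x)) \<partial>lebesgue)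
          \<le> Lp_norm q (\<lambda>\<xi>. fourier_integral (D n) \<xi> - k \<xi>) * Lp_norm p \<phi>"
        using pq by (intro Holder_Lp_norm[OF q p]) (auto simp: add.commute)
      also have "\<dots> < \<infinity>"
        using less_trans[OF that ennreal_one_less_top] \<phi>_fin by (auto simp: ennreal_mult_less_top)
      finally have d_int: "integrable lebesgue (\<lambda>x. (fourier_integral (D n) x - k x) * \<phi> x)"
        by (intro integrableI_bounded) auto
      have f_int: "integrable lebesgue (\<lambda>x. fourier_integral (D n) x * \<phi> x)"
        by (rule integrable_fourier_integral_mult[OF D \<phi>_int])
      have k_int: "integrable lebesgue (\<lambda>x. k x * \<phi> x)"
        using Bochner_Integration.integrable_diff[OF f_int d_int] by (simp add: algebra_simps)
      have "(\<integral>\<^sup>+ x. ennreal (cmod (k x * \<phi> x)) \<partial>lebesgue) =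
          ennreal (LINT x|lebesgue. cmod (k x * \<phi> x))"
        using k_int by (intro nn_integral_eq_integral integrable_norm) auto
      also have "(LINT x|lebesgue. cmod (k x * \<phi> x)) = cmod (LINT x|lebesgue. k x * \<phi> x)"
        unfolding k\<phi> integral_complex_of_real norm_of_real by (simp add: abs_mult)
      also have "(LINT x|lebesgue. k x * \<phi> x) =
          (LINT x|lebesgue. fourier_integral (D n) x * \<phi> x - (fourier_integral (D n) x - k x) * \<phi> x)"
        by (simp add: algebra_simps)
      also have "\<dots> = (LINT x|lebesgue. D n x * fourier_integral \<phi> x)
          - (LINT x|lebesgue. (fourier_integral (D n) x - k x) * \<phi> x)"
        using fourier_multiplication_formula[OF D \<phi>_int]
        by (subst Bochner_Integration.integral_diff[OF f_int d_int]) simp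
      also have "ennreal (cmod \<dots>) \<le> ennreal (cmod (LINT x|lebesgue. (fourier_integral (D n) x - k x) * \<phi> x))
          + ennreal (cmod (LINT x|lebesgue. D n x * fourier_integral \<phi> x))"
        unfolding ennreal_plus[OF norm_ge_zero norm_ge_zero, symmetric]
        by (intro ennreal_leI) (rule order_trans[OF norm_triangle_ineq4 eq_refl[OF add.commute]])
      also have "\<dots> \<le> e n"
        unfolding e_def
      proof (rule add_mono)
        show "ennreal (cmod (LINT x|lebesgue. (fourier_integral (D n) x - k x) * \<phi> x)) \<le>
           Lp_norm q (\<lambda>\<xi>. fourier_integral (D n) \<xi> - k \<xi>) * Lp_norm p \<phi>"
          by (rule order_trans[OF integral_norm_bound_ennreal[OF d_int] H])
        have "integrable lebesgue (\<lambda>x. fourier_integral \<phi> x * D n x)"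
          by (rule integrable_fourier_integral_mult[OF \<phi>_int D])
        then show "ennreal (cmod (LINT x|lebesgue. D n x * fourier_integral \<phi> x)) \<le>
            Lp_norm p (D n) * Lp_norm q (fourier_integral \<phi>)"
          by (intro order_trans[OF integral_norm_bound_ennreal Holder_Lp_norm[OF p q pq]])
             (auto simp: mult.commute)
      qed
      finally show ?thesis .
    qed
    have "e \<longlonglongrightarrow> 0 * Lp_norm p \<phi> + 0 * Lp_norm q (fourier_integral \<phi>)"
      unfolding e_def using \<phi>_fin dual[OF \<phi>_meas \<phi>_bd]
      by (intro tendsto_add tendsto_mult_ennreal tendsto_const klim Dlim) auto
    then have "e \<longlonglongrightarrow> 0" by simp
    moreover have "eventually (\<lambda>n. (\<integral>\<^sup>+ x. ennreal (cmod (k x * \<phi> x)) \<partial>lebesgue) \<le> e n) sequentially"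
      using order_tendstoD(2)[OF klim, of 1] by (auto intro: bound elim!: eventually_mono)
    ultimately have "(\<integral>\<^sup>+ x. ennreal (cmod (k x * \<phi> x)) \<partial>lebesgue) \<le> 0"
      by (rule tendsto_lowerbound) simp
    then have "AE x in lebesgue. ennreal (cmod (k x * \<phi> x)) = 0"
      by (subst nn_integral_0_iff_AE[symmetric]) auto
    then show ?thesis
      by eventually_elim (auto simp: k\<phi> ennreal_eq_0_iff)
  qed
  have "AE x in lebesgue. \<forall>R::nat. x \<in> ball 0 (real R) \<longrightarrow> k x = 0"
    using ball_zero by (subst AE_all_countable) auto
  then show ?thesis
  proof eventually_elim
    case (elim x)
    obtain R :: nat where "norm x < real R" using reals_Archimedean2 by blast
    with elim show ?case by auto
  qed
qed

text \<open>
  Two approximating sequences of the same function differ by a sequence that tends to 0 in \<open>L\<^sup>p\<close>, so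
  closability applies to the difference of the two limits.
\<close>

lemma is_fourier_limit_unique:
  fixes f g h :: "real^'d::finite \<Rightarrow> complex"
  assumes p: "1 < p" and q: "q = conj_exp p"
    and [measurable]: "f \<in> borel_measurable lebesgue"
    and g: "is_fourier_limit p f g" and h: "is_fourier_limit p f h"
    and dual: "\<And>R \<phi> :: real^'d \<Rightarrow> complex. \<phi> \<in> borel_measurable lebesgue \<Longrightarrow>
        (\<And>x. cmod (\<phi> x) \<le> indicator (ball 0 R) x) \<Longrightarrow> Lp_norm q (fourier_integral \<phi>) < \<infinity>"
  shows "AE x in lebesgue. g x = h x"
proof -
  have q1: "1 < q" and pq: "1 / p + 1 / q = 1"
    using p by (auto simp: q conj_exp_def field_simps)
  obtain F where F: "\<And>n. integrable lebesgue (F n)" and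
      Ff: "(\<lambda>n. Lp_norm p (\<lambda>x. F n x - f x)) \<longlonglongrightarrow> 0" and
      Fg: "(\<lambda>n. Lp_norm q (\<lambda>\<xi>. fourier_integral (F n) \<xi> - g \<xi>)) \<longlonglongrightarrow> 0"
    using g unfolding is_fourier_limit_def q by blast
  obtain G where G: "\<And>n. integrable lebesgue (G n)" and
      Gf: "(\<lambda>n. Lp_norm p (\<lambda>x. G n x - f x)) \<longlonglongrightarrow> 0" and
      Gh: "(\<lambda>n. Lp_norm q (\<lambda>\<xi>. fourier_integral (G n) \<xi> - h \<xi>)) \<longlonglongrightarrow> 0"
    using h unfolding is_fourier_limit_def q by blast
  have [measurable]: "F n \<in> borel_measurable lebesgue" "G n \<in> borel_measurable lebesgue" for n
    using F G by auto
  have [measurable]: "g \<in> borel_measurable lebesgue" "h \<in> borel_measurable lebesgue"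
    using g h by (auto simp: is_fourier_limit_def Lp_fun_def)
  have diff_bound: "Lp_norm r (\<lambda>x. u x - v x) \<le> Lp_norm r u + Lp_norm r v"
    if "1 \<le> r" "u \<in> borel_measurable lebesgue" "v \<in> borel_measurable lebesgue"
    for r and u v :: "real^'d \<Rightarrow> complex"
    using Lp_norm_triangle[OF that(1,2), of "\<lambda>x. - v x"] Lp_norm_cong_AE[of r "\<lambda>x. - v x" v] that
    by simp
  have squeeze0: "A \<longlonglongrightarrow> 0" if "\<And>n. A n \<le> B n + C n" "B \<longlonglongrightarrow> 0" "C \<longlonglongrightarrow> 0" for A B C :: "nat \<Rightarrow> ennreal"
    using tendsto_sandwich[of "\<lambda>_. 0" A sequentially "\<lambda>n. B n + C n" 0] tendsto_add[OF that(2,3)] that(1)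
    by simp
  have "AE x in lebesgue. g x - h x = 0"
  proof (rule fourier_limit_zero[OF p q1 pq, where D = "\<lambda>n x. F n x - G n x"])
    show "(\<lambda>n. Lp_norm q (\<lambda>\<xi>. fourier_integral (\<lambda>x. F n x - G n x) \<xi> - (g \<xi> - h \<xi>))) \<longlonglongrightarrow> 0"
    proof (rule squeeze0[OF _ Fg Gh])
      fix n
      have "(\<lambda>\<xi>. fourier_integral (\<lambda>x. F n x - G n x) \<xi> - (g \<xi> - h \<xi>)) =
          (\<lambda>\<xi>. (fourier_integral (F n) \<xi> - g \<xi>) - (fourier_integral (G n) \<xi> - h \<xi>))"
        by (simp add: fourier_integral_diff F G fun_eq_iff)
      then show "Lp_norm q (\<lambda>\<xi>. fourier_integral (\<lambda>x. F n x - G n x) \<xi> - (g \<xi> - h \<xi>)) \<le>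
          Lp_norm q (\<lambda>\<xi>. fourier_integral (F n) \<xi> - g \<xi>) + Lp_norm q (\<lambda>\<xi>. fourier_integral (G n) \<xi> - h \<xi>)"
        using q1 by (simp only:) (intro diff_bound, auto)
    qed
    show "(\<lambda>n. Lp_norm p (\<lambda>x. F n x - G n x)) \<longlonglongrightarrow> 0"
    proof (rule squeeze0[OF _ Ff Gf])
      fix n
      have "Lp_norm p (\<lambda>x. (F n x - f x) - (G n x - f x)) \<le>
          Lp_norm p (\<lambda>x. F n x - f x) + Lp_norm p (\<lambda>x. G n x - f x)"
        using p by (intro diff_bound) auto
      then show "Lp_norm p (\<lambda>x. F n x - G n x) \<le>
          Lp_norm p (\<lambda>x. F n x - f x) + Lp_norm p (\<lambda>x. G n x - f x)" by simp
    qed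
    show "Lp_norm q (fourier_integral \<phi>) < \<infinity>"
      if "\<phi> \<in> borel_measurable lebesgue" "\<And>x. cmod (\<phi> x) \<le> indicator (ball 0 R) x"
      for R and \<phi> :: "real^'d \<Rightarrow> complex"
      using that by (rule dual)
  qed (use F G in auto)
  then show ?thesis by (rule eventually_mono) simp
qed

section \<open>Binary layers of a bounded function\<close>

lemma measure_pos:
  assumes "0 < emeasure M A" "emeasure M A < \<infinity>"
  shows "0 < measure M A"
  using assms by (simp add: measure_def enn2real_positive_iff)

text \<open>
  The greedy binary expansion: step \<open>k\<close> takes the digit of weight \<open>2\<^bsup>-(k+1)\<^esup>\<close> whenever it fits. With this
  convention the expansion of 1 is \<open>0.111\<dots>\<close>, so all of \<open>{0..1}\<close> is covered by the digits after the point.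
\<close>

primrec binary_remainder :: "real \<Rightarrow> nat \<Rightarrow> real" where
  "binary_remainder t 0 = t"
| "binary_remainder t (Suc k) =
     binary_remainder t k - (if (1/2) ^ Suc k \<le> binary_remainder t k then (1/2) ^ Suc k else 0)"

lemma binary_remainder_bounds:
  assumes "0 \<le> t" "t \<le> 1"
  shows "0 \<le> binary_remainder t k \<and> binary_remainder t k \<le> (1/2) ^ k"
  using assms by (induction k) auto

lemma binary_remainder_zero: "binary_remainder 0 k = 0"
  by (induction k) (auto simp: not_le)

lemma measurable_binary_remainder [measurable]:
  assumes [measurable]: "g \<in> borel_measurable M"
  shows "(\<lambda>x. binary_remainder (g x) k) \<in> borel_measurable M"
  by (induction k) auto

lemma binary_expansion_sums:
  assumes "0 \<le> t" "t \<le> 1"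
  shows "(\<lambda>k. if (1/2) ^ Suc k \<le> binary_remainder t k then (1/2) ^ Suc k else 0) sums t"
proof -
  have eq: "(\<Sum>k<n. if (1/2) ^ Suc k \<le> binary_remainder t k then (1/2) ^ Suc k else 0) =
      t - binary_remainder t n" for n
    by (induction n) auto
  have "(\<lambda>n. binary_remainder t n) \<longlonglongrightarrow> 0"
  proof (rule tendsto_sandwich[of "\<lambda>_. 0" _ _ "\<lambda>n. (1/2) ^ n"])
    show "(\<lambda>n. (1/2) ^ n :: real) \<longlonglongrightarrow> 0" by (rule LIMSEQ_realpow_zero) auto
  qed (use binary_remainder_bounds[OF assms] in auto)
  then have "(\<lambda>n. t - binary_remainder t n) \<longlonglongrightarrow> t - 0"
    by (intro tendsto_intros)
  then show ?thesis by (simp only: sums_def eq diff_0_right)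
qed

text \<open>
  Layer \<open>k\<close> is the set where \<open>\<bar>f\<bar>\<close> has binary digit 1 at weight \<open>2\<^bsup>-(k+1)\<^esup>\<close>. It lies in \<open>A\<close>, so in the
  normalisation of \<open>L_norm\<close> it costs at most \<open>2\<^bsup>-(k+1)\<^esup> \<bar>A\<bar>\<^bsup>1/p\<^esup>\<close>. Summing over \<open>k\<close> gives the claim.
\<close>

lemma L_norm_indicator_bound:
  fixes f :: "real^'d::finite \<Rightarrow> complex"
  assumes p: "0 < p" and A: "A \<in> sets lebesgue" "0 < emeasure lebesgue A" "emeasure lebesgue A < \<infinity>"
    and f [measurable]: "f \<in> borel_measurable lebesgue" and bd: "\<And>x. cmod (f x) \<le> indicator A x"
  shows "L_norm p f \<le> ennreal_powr (emeasure lebesgue A) (1 / p)"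
proof -
  define layer where "layer k = {x. (1/2) ^ Suc k \<le> binary_remainder (cmod (f x)) k}" for k
  \<comment> \<open>The sets of a representation must have positive measure: a null layer is replaced by \<open>A\<close> with
    coefficient 0, which changes the sum on a null set only.\<close>
  define E where "E k = (if 0 < emeasure lebesgue (layer k) then layer k else A)" for k
  define a where "a k = (if 0 < emeasure lebesgue (layer k)
      then (1/2) ^ Suc k * measure lebesgue (layer k) powr (1 / p) else 0)" for k
  \<comment> \<open>Keeps the measures of the layers as they are, instead of as Borel measures of main parts.\<close>
  note emeasure_completion [simp del]
  have layer_sets [measurable]: "layer k \<in> sets lebesgue" for k
  proof -
    have "{x \<in> space lebesgue. (1/2) ^ Suc k \<le> binary_remainder (cmod (f x)) k} \<in> sets lebesgue"
      by measurable
    then show ?thesis by (simp add: layer_def)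
  qed
  have layer_sub: "layer k \<subseteq> A" for k
  proof
    fix x assume x: "x \<in> layer k"
    show "x \<in> A"
    proof (rule ccontr)
      assume "x \<notin> A"
      then have "cmod (f x) = 0" using bd[of x] by simp
      then have "(1/2) ^ Suc k \<le> (0::real)"
        using x by (simp only: layer_def mem_Collect_eq binary_remainder_zero)
      moreover have "(0::real) < (1/2) ^ Suc k" by simp
      ultimately show False by linarith
    qed
  qed
  have layer_le: "emeasure lebesgue (layer k) \<le> emeasure lebesgue A" for k
    by (intro emeasure_mono layer_sub A)
  have layer_fin: "emeasure lebesgue (layer k) < \<infinity>" for k
    using layer_le A(3) by (rule le_less_trans)
  have layer_measure_le: "measure lebesgue (layer k) \<le> measure lebesgue A" for k
    unfolding measure_def using layer_le A(3) by (intro enn2real_mono) auto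
  have E: "\<forall>k. E k \<in> sets lebesgue \<and> 0 < emeasure lebesgue (E k) \<and> emeasure lebesgue (E k) < \<infinity>"
    using A layer_fin by (auto simp: E_def)
  have a0: "\<forall>k. 0 \<le> a k" by (auto simp: a_def)
  have null: "AE x in lebesgue. \<forall>k. emeasure lebesgue (layer k) = 0 \<longrightarrow> x \<notin> layer k"
    unfolding AE_all_countable
  proof
    fix k
    show "AE x in lebesgue. emeasure lebesgue (layer k) = 0 \<longrightarrow> x \<notin> layer k"
      by (cases "emeasure lebesgue (layer k) = 0") (auto intro!: AE_not_in simp: null_sets_def)
  qed
  have rep: "AE x in lebesgue. ennreal (cmod (f x)) =
      (\<Sum>k. ennreal (a k * measure lebesgue (E k) powr (- 1 / p) * indicator (E k) x))"
    using null
  proof eventually_elim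
    case (elim x)
    have term_eq: "a k * measure lebesgue (E k) powr (- 1 / p) * indicator (E k) x =
        (if (1/2) ^ Suc k \<le> binary_remainder (cmod (f x)) k then (1/2) ^ Suc k else 0)" for k
    proof (cases "emeasure lebesgue (layer k) = 0")
      case True
      then have "x \<notin> layer k" "a k = 0" using elim by (auto simp: a_def)
      then show ?thesis by (simp only: layer_def mem_Collect_eq if_False mult_zero_left)
    next
      case False
      then have pos: "0 < emeasure lebesgue (layer k)" by (simp add: zero_less_iff_neq_zero)
      then have "0 < measure lebesgue (layer k)" using layer_fin by (rule measure_pos)
      then have "measure lebesgue (layer k) powr (1 / p) * measure lebesgue (layer k) powr (- 1 / p) = 1"
        by (simp add: powr_add[symmetric])
      moreover have "a k = (1/2) ^ Suc k * measure lebesgue (layer k) powr (1 / p)" "E k = layer k"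
        using pos by (simp_all only: a_def E_def if_True)
      ultimately have "a k * measure lebesgue (E k) powr (- 1 / p) = (1/2) ^ Suc k"
        by (simp only: mult.assoc mult_1_right)
      then show ?thesis
        unfolding \<open>E k = layer k\<close> by (simp only: layer_def indicator_def mem_Collect_eq) simp
    qed
    have "cmod (f x) \<le> 1" using bd[of x] by (cases "x \<in> A") auto
    then have "(\<lambda>k. a k * measure lebesgue (E k) powr (- 1 / p) * indicator (E k) x) sums cmod (f x)"
      unfolding term_eq by (intro binary_expansion_sums) auto
    then show ?case
      using a0 by (intro sym[OF suminf_ennreal_eq]) (auto intro!: mult_nonneg_nonneg)
  qed
  have sums: "(\<lambda>k. (1/2) ^ Suc k * measure lebesgue A powr (1 / p)) sums (1 * measure lebesgue A powr (1 / p))"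
    by (intro sums_mult2 power_half_series)
  have "L_norm p f \<le> (\<Sum>k. ennreal (a k))"
    unfolding L_norm_def using a0 E rep by (intro Inf_lower) blast
  also have "\<dots> \<le> (\<Sum>k. ennreal ((1/2) ^ Suc k * measure lebesgue A powr (1 / p)))"
  proof (intro suminf_le ennreal_leI summableI)
    show "a k \<le> (1/2) ^ Suc k * measure lebesgue A powr (1 / p)" for k
    proof (cases "0 < emeasure lebesgue (layer k)")
      case True
      have "measure lebesgue (layer k) powr (1 / p) \<le> measure lebesgue A powr (1 / p)"
        using p layer_measure_le by (intro powr_mono2) auto
      then show ?thesis
        unfolding a_def if_P[OF True] by (intro mult_left_mono) auto
    next
      case False
      show ?thesis unfolding a_def if_not_P[OF False] by simp
    qed
  qed
  also have "\<dots> = ennreal (measure lebesgue A powr (1 / p))"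
    by (rule trans[OF suminf_ennreal_eq[OF _ sums]]) simp_all
  also have "\<dots> = ennreal_powr (emeasure lebesgue A) (1 / p)"
    using A(3) by (simp add: ennreal_powr_def measure_def)
  finally show ?thesis .
qed

section \<open>Bounds by the restricted constant\<close>

lemma B_const_bound:
  fixes f :: "real^'d::finite \<Rightarrow> complex"
  assumes A: "A \<in> sets lebesgue" "0 < emeasure lebesgue A" "emeasure lebesgue A < \<infinity>"
    and f: "f \<in> borel_measurable lebesgue" "\<And>x. cmod (f x) \<le> indicator A x"
  shows "Lp_norm q (fourier_integral f) \<le>
    B_const TYPE('d) q * ennreal_powr (emeasure lebesgue A) (1 / conj_exp q)"
proof -
  have eq: "fourier (conj_exp q) f = fourier_integral f"
    using integrable_indicator_bound[OF f(1) A(1,3) f(2)] by (simp add: fourier_def)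
  have le: "Lp_norm q (fourier_integral f) / ennreal_powr (emeasure lebesgue A) (1 / conj_exp q)
      \<le> B_const TYPE('d) q"
    unfolding B_const_def eq[symmetric]
    by (rule SUP_upper2[of A], use A in simp, rule SUP_upper2[of f]) (use f in auto)
  have "ennreal_powr (emeasure lebesgue A) (1 / conj_exp q) \<noteq> 0"
    "ennreal_powr (emeasure lebesgue A) (1 / conj_exp q) \<noteq> \<infinity>"
    using A by (auto simp: ennreal_powr_def enn2real_positive_iff ennreal_eq_0_iff dest: enn2real_eq_0_iff[THEN iffD1])
  then have "Lp_norm q (fourier_integral f) =
      Lp_norm q (fourier_integral f) / ennreal_powr (emeasure lebesgue A) (1 / conj_exp q)
        * ennreal_powr (emeasure lebesgue A) (1 / conj_exp q)"
    by (simp add: ennreal_divide_times less_top)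
  also have "\<dots> \<le> B_const TYPE('d) q * ennreal_powr (emeasure lebesgue A) (1 / conj_exp q)"
    by (intro mult_right_mono le) auto
  finally show ?thesis .
qed

lemma inverse_ennreal_antimono:
  fixes a b :: ennreal
  assumes "a \<le> b"
  shows "inverse b \<le> inverse a"
  using assms including ennreal.lifting by transfer (rule ereal_inverse_antimono)

text \<open>
  The pieces \<open>u n\<close> carry the sign of \<open>f\<close>, so \<open>f\<close> is a.e. the sum of the \<open>u n\<close>, with partial sums \<open>s N\<close>
  dominated by \<open>f\<close>. The function \<open>W\<close>, the sum of the moduli of the transforms \<open>U n\<close>, dominates the
  transforms of all \<open>s N\<close> and hence every limit of them. Its norm is at most \<open>B \<Sum>n. a n\<close> by the
  countable Minkowski inequality, so it suffices to see that the transform of \<open>f\<close> is such a limit.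
\<close>

lemma fourier_bound_of_representation:
  fixes f :: "real^'d::finite \<Rightarrow> complex"
  assumes p: "1 < p" and q: "q = conj_exp p" and f: "f \<in> Lp_fun p"
    and B: "B_const TYPE('d) q < \<infinity>"
    and a: "\<And>n. 0 \<le> a n"
    and E: "\<And>n. E n \<in> sets lebesgue" "\<And>n. 0 < emeasure lebesgue (E n)" "\<And>n. emeasure lebesgue (E n) < \<infinity>"
    and rep: "AE x in lebesgue. ennreal (cmod (f x)) =
        (\<Sum>n. ennreal (a n * measure lebesgue (E n) powr (- 1 / p) * indicator (E n) x))"
    and fin: "(\<Sum>n. ennreal (a n)) < \<infinity>"
  shows "Lp_norm q (fourier p f) \<le> B_const TYPE('d) q * (\<Sum>n. ennreal (a n))"
proof -
  have q1: "1 < q" and conj: "conj_exp q = p"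
    using p by (auto simp: q conj_exp_def field_simps)
  note [measurable] = E(1)
  have f_meas [measurable]: "f \<in> borel_measurable lebesgue" and f_fin: "Lp_norm p f < \<infinity>"
    using f by (auto simp: Lp_fun_def)
  define c where "c n = a n * measure lebesgue (E n) powr (- 1 / p)" for n
  have c0: "0 \<le> c n" for n using a by (simp add: c_def)
  \<comment> \<open>\<open>h n\<close> is admissible for the set \<open>E n\<close> in the definition of \<open>B_const\<close>.\<close>
  define h where "h n x = sgn (f x) * indicator (E n) x" for n x
  have h_meas [measurable]: "h n \<in> borel_measurable lebesgue" for n
    unfolding h_def sgn_eq by measurable
  have h_bd: "cmod (h n x) \<le> indicator (E n) x" for n x
    by (auto simp: h_def norm_mult norm_sgn indicator_def)
  have h_int: "integrable lebesgue (h n)" for n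
    by (rule integrable_indicator_bound[OF h_meas E(1) E(3) h_bd])
  define u where "u n x = complex_of_real (c n) * h n x" for n x
  have u_int: "integrable lebesgue (u n)" for n
    unfolding u_def by (intro integrable_mult_right h_int)
  have u_meas [measurable]: "u n \<in> borel_measurable lebesgue" for n
    using u_int by auto
  define U where "U n = fourier_integral (u n)" for n
  have U_meas [measurable]: "U n \<in> borel_measurable lebesgue" for n
    unfolding U_def by measurable
  have U_bd: "Lp_norm q (U n) \<le> ennreal (a n) * B_const TYPE('d) q" for n
  proof -
    have mpos: "0 < measure lebesgue (E n)"
      by (intro measure_pos E)
    have "U n = (\<lambda>\<xi>. complex_of_real (c n) * fourier_integral (h n) \<xi>)"
      unfolding U_def u_def by (rule ext) (rule fourier_integral_cmult)
    then have "Lp_norm q (U n) = ennreal (c n) * Lp_norm q (fourier_integral (h n))"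
      using q1 c0 by (simp add: Lp_norm_cmult)
    also have "\<dots> \<le> ennreal (c n) * (B_const TYPE('d) q * ennreal_powr (emeasure lebesgue (E n)) (1 / p))"
      using B_const_bound[OF E(1) E(2) E(3) h_meas h_bd, where q = q] by (intro mult_left_mono) (auto simp: conj)
    also have "ennreal_powr (emeasure lebesgue (E n)) (1 / p) = ennreal (measure lebesgue (E n) powr (1 / p))"
      using E(3)[of n] by (simp add: ennreal_powr_def measure_def)
    also have "ennreal (c n) * (B_const TYPE('d) q * ennreal (measure lebesgue (E n) powr (1 / p))) =
        ennreal (c n * measure lebesgue (E n) powr (1 / p)) * B_const TYPE('d) q"
      using c0 by (simp add: ennreal_mult ac_simps)
    also have "c n * measure lebesgue (E n) powr (1 / p) = a n"
      using mpos by (simp add: c_def mult.assoc powr_add[symmetric])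
    finally show ?thesis .
  qed
  have U_sum: "(\<Sum>n. Lp_norm q (U n)) \<le> (\<Sum>n. ennreal (a n)) * B_const TYPE('d) q"
    by (subst ennreal_suminf_multc[symmetric]) (intro suminf_le U_bd summableI)
  also have "\<dots> < \<infinity>"
    using fin B by (auto simp: ennreal_mult_less_top)
  finally have U_fin: "(\<Sum>n. Lp_norm q (U n)) < \<infinity>" .
  define W where "W \<xi> = complex_of_real (\<Sum>n. cmod (U n \<xi>))" for \<xi>
  have W_meas [measurable]: "W \<in> borel_measurable lebesgue"
    unfolding W_def by measurable
  have summ: "AE \<xi> in lebesgue. summable (\<lambda>n. cmod (U n \<xi>))"
    and W_bd: "Lp_norm q W \<le> (\<Sum>n. Lp_norm q (U n))"
    using Lp_norm_suminf[OF _ U_meas U_fin] q1 by (auto simp: W_def[abs_def])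
  have part_le_W: "cmod (\<Sum>n<N. U n \<xi>) \<le> cmod (W \<xi>)" if "summable (\<lambda>n. cmod (U n \<xi>))" for N \<xi>
  proof -
    have "cmod (\<Sum>n<N. U n \<xi>) \<le> (\<Sum>n<N. cmod (U n \<xi>))" by (rule norm_sum)
    also have "\<dots> \<le> (\<Sum>n. cmod (U n \<xi>))" by (rule sum_le_suminf[OF that]) auto
    finally show ?thesis by (auto simp only: W_def norm_of_real intro: order_trans abs_ge_self)
  qed
  define s where "s N x = (\<Sum>n<N. u n x)" for N x
  have s_int: "integrable lebesgue (s N)" for N
    unfolding s_def by (intro Bochner_Integration.integrable_sum u_int)
  have s_meas [measurable]: "s N \<in> borel_measurable lebesgue" for N
    using s_int by auto
  have s_transform: "fourier_integral (s N) \<xi> = (\<Sum>n<N. U n \<xi>)" for N \<xi>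
    unfolding s_def U_def by (intro fourier_integral_sum u_int)
  have s_conv: "AE x in lebesgue. (\<lambda>N. s N x) \<longlonglongrightarrow> f x \<and> (\<forall>N. cmod (s N x) \<le> cmod (f x))"
    using rep
  proof eventually_elim
    case (elim x)
    let ?t = "\<lambda>n. c n * indicator (E n) x"
    have t0: "0 \<le> ?t n" for n using c0 by simp
    have eq: "ennreal (cmod (f x)) = (\<Sum>n. ennreal (?t n))"
      using elim by (simp add: c_def)
    have sm: "summable ?t"
      using t0 eq by (intro summable_suminf_not_top) (auto simp: eq[symmetric])
    have cm: "cmod (f x) = (\<Sum>n. ?t n)"
      using eq suminf_ennreal_eq[OF t0 summable_sums[OF sm]] t0 sm by (simp add: suminf_nonneg)
    with sm have ts: "?t sums cmod (f x)" by (simp add: summable_sums)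
    have s_eq: "s N x = sgn (f x) * complex_of_real (\<Sum>n<N. ?t n)" for N
      unfolding s_def u_def h_def of_real_sum sum_distrib_left
      by (intro sum.cong) (auto simp: indicator_def)
    have "(\<lambda>N. sgn (f x) * complex_of_real (\<Sum>n<N. ?t n)) \<longlonglongrightarrow> sgn (f x) * complex_of_real (cmod (f x))"
      using ts unfolding sums_def by (intro tendsto_intros)
    moreover have "sgn (f x) * complex_of_real (cmod (f x)) = f x"
      by (simp add: sgn_eq)
    moreover have "cmod (s N x) \<le> cmod (f x)" for N
    proof -
      have "(\<Sum>n<N. ?t n) \<le> cmod (f x)"
        unfolding cm by (rule sum_le_suminf[OF sm]) (use t0 in auto)
      moreover have "0 \<le> (\<Sum>n<N. ?t n)" by (intro sum_nonneg t0)
      ultimately show ?thesis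
        unfolding s_eq norm_mult norm_of_real by (simp add: norm_sgn)
    qed
    ultimately show ?case by (simp add: s_eq)
  qed
  have "AE \<xi> in lebesgue. cmod (fourier p f \<xi>) \<le> cmod (W \<xi>)"
  proof (cases "integrable lebesgue f")
    case True
    have lim: "(\<lambda>N. fourier_integral (s N) \<xi>) \<longlonglongrightarrow> fourier_integral f \<xi>" for \<xi>
      unfolding fourier_integral_eq
    proof (rule integral_dominated_convergence[where w = "\<lambda>x. cmod (f x)"])
      show "(\<lambda>x. fourier_kernel x \<xi> * f x) \<in> borel_measurable lebesgue"
        by (intro borel_measurable_integrable integrable_fourier_kernel_mult True)
      show "(\<lambda>x. fourier_kernel x \<xi> * s N x) \<in> borel_measurable lebesgue" for N
        by (intro borel_measurable_integrable integrable_fourier_kernel_mult s_int)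
      show "AE x in lebesgue. (\<lambda>N. fourier_kernel x \<xi> * s N x) \<longlonglongrightarrow> fourier_kernel x \<xi> * f x"
        using s_conv by eventually_elim (intro tendsto_intros, simp)
      show "AE x in lebesgue. norm (fourier_kernel x \<xi> * s N x) \<le> cmod (f x)" for N
        using s_conv by eventually_elim (simp add: norm_mult)
    qed (use True in auto)
    from summ show ?thesis
    proof eventually_elim
      case (elim \<xi>)
      have "cmod (fourier_integral f \<xi>) \<le> cmod (W \<xi>)"
        using tendsto_norm[OF lim[of \<xi>]] part_le_W[OF elim]
        by (intro LIMSEQ_le_const2) (auto simp: s_transform)
      then show ?case using True by (simp add: fourier_def)
    qed
  next
    case False
    \<comment> \<open>Off \<open>L\<^sup>1\<close> the transform is a choice among the Fourier limits: \<open>g\<close> shows that one exists, and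
      uniqueness carries the bound from \<open>g\<close> to the chosen one.\<close>
    define g where "g \<xi> = (\<Sum>n. U n \<xi>)" for \<xi>
    have g_meas [measurable]: "g \<in> borel_measurable lebesgue"
      unfolding g_def by measurable
    have g_conv: "AE \<xi> in lebesgue. (\<lambda>N. fourier_integral (s N) \<xi>) \<longlonglongrightarrow> g \<xi> \<and>
        (\<forall>N. cmod (fourier_integral (s N) \<xi>) \<le> cmod (W \<xi>)) \<and> cmod (g \<xi>) \<le> cmod (W \<xi>)"
      using summ
    proof eventually_elim
      case (elim \<xi>)
      have lim: "(\<lambda>N. fourier_integral (s N) \<xi>) \<longlonglongrightarrow> g \<xi>"
        unfolding s_transform g_def by (rule summable_LIMSEQ[OF summable_norm_cancel[OF elim]])
      moreover have bd: "\<forall>N. cmod (fourier_integral (s N) \<xi>) \<le> cmod (W \<xi>)"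
        using part_le_W[OF elim] by (simp add: s_transform)
      ultimately show ?case
        using LIMSEQ_le_const2[OF tendsto_norm[OF lim]] by auto
    qed
    have W_fin: "Lp_norm q W < \<infinity>" using W_bd U_fin by (rule le_less_trans)
    have lim_g: "is_fourier_limit p f g"
      unfolding is_fourier_limit_def q[symmetric]
    proof (intro conjI exI[of _ s] allI s_int)
      have "Lp_norm q g \<le> Lp_norm q W"
        using q1 g_conv by (intro Lp_norm_mono_AE) (auto elim: eventually_mono)
      then show "g \<in> Lp_fun q" using W_fin by (auto simp: Lp_fun_def intro: le_less_trans)
      show "s N \<in> Lp_fun p" for N
      proof -
        have "Lp_norm p (s N) \<le> Lp_norm p f"
          using p s_conv by (intro Lp_norm_mono_AE) (auto elim: eventually_mono)
        then show ?thesis using f_fin by (auto simp: Lp_fun_def intro: le_less_trans)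
      qed
      show "(\<lambda>N. Lp_norm p (\<lambda>x. s N x - f x)) \<longlonglongrightarrow> 0"
      proof (rule Lp_norm_dominated_convergence[where w = "\<lambda>x. 2 * f x"])
        show "Lp_norm p (\<lambda>x. 2 * f x) < \<infinity>"
          using p f_fin by (subst Lp_norm_cmult) (auto simp: ennreal_mult_less_top)
        show "AE x in lebesgue. cmod (s N x - f x) \<le> cmod (2 * f x)" for N
          using s_conv
        proof eventually_elim
          case (elim x)
          then have "cmod (s N x) \<le> cmod (f x)" by simp
          with norm_triangle_ineq4[of "s N x" "f x"] show ?case
            unfolding norm_mult norm_numeral by linarith
        qed
        show "AE x in lebesgue. (\<lambda>N. s N x - f x) \<longlonglongrightarrow> 0"
          using s_conv by eventually_elim (simp add: LIM_zero)
      qed (use p in auto)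
      show "(\<lambda>N. Lp_norm q (\<lambda>\<xi>. fourier_integral (s N) \<xi> - g \<xi>)) \<longlonglongrightarrow> 0"
      proof (rule Lp_norm_dominated_convergence[where w = "\<lambda>x. 2 * W x"])
        show "Lp_norm q (\<lambda>x. 2 * W x) < \<infinity>"
          using q1 W_fin by (subst Lp_norm_cmult) (auto simp: ennreal_mult_less_top)
        show "AE \<xi> in lebesgue. cmod (fourier_integral (s N) \<xi> - g \<xi>) \<le> cmod (2 * W \<xi>)" for N
          using g_conv
        proof eventually_elim
          case (elim \<xi>)
          then have "cmod (fourier_integral (s N) \<xi>) \<le> cmod (W \<xi>)" "cmod (g \<xi>) \<le> cmod (W \<xi>)" by auto
          with norm_triangle_ineq4[of "fourier_integral (s N) \<xi>" "g \<xi>"] show ?case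
            unfolding norm_mult norm_numeral by linarith
        qed
        show "AE \<xi> in lebesgue. (\<lambda>N. fourier_integral (s N) \<xi> - g \<xi>) \<longlonglongrightarrow> 0"
          using g_conv by eventually_elim (simp add: LIM_zero)
      qed (use q1 in auto)
    qed
    have "fourier p f = (SOME g. is_fourier_limit p f g)"
      using False by (simp add: fourier_def)
    then have lim_fourier: "is_fourier_limit p f (fourier p f)"
      using someI[of "is_fourier_limit p f", OF lim_g] by (simp only:)
    have "AE \<xi> in lebesgue. fourier p f \<xi> = g \<xi>"
    proof (rule is_fourier_limit_unique[OF p q f_meas lim_fourier lim_g])
      fix R and \<phi> :: "real^'d \<Rightarrow> complex"
      assume \<phi>: "\<phi> \<in> borel_measurable lebesgue" "\<And>x. cmod (\<phi> x) \<le> indicator (ball 0 R) x"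
      \<comment> \<open>The sets in \<open>B_const\<close> have positive measure, so the ball is enlarged when \<open>R \<le> 0\<close>.\<close>
      let ?R = "max R 1"
      have \<phi>': "cmod (\<phi> x) \<le> indicator (ball 0 ?R) x" for x
        by (rule order_trans[OF \<phi>(2)]) (auto simp: indicator_def)
      have fin_ball: "emeasure lebesgue (ball (0::real^'d) ?R) < \<infinity>"
        using lmeasurable_ball[of "0::real^'d" ?R] by (simp add: fmeasurable_def)
      have "0 < measure lebesgue (ball (0::real^'d) ?R)"
        using content_ball_pos[of ?R "0::real^'d"] by simp
      then have "0 < emeasure lebesgue (ball (0::real^'d) ?R)"
        by (intro gr_zeroI) (simp add: measure_def del: emeasure_completion)
      then have "Lp_norm q (fourier_integral \<phi>) \<le>
          B_const TYPE('d) q * ennreal_powr (emeasure lebesgue (ball (0::real^'d) ?R)) (1 / conj_exp q)"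
        using fin_ball \<phi>(1) \<phi>' by (intro B_const_bound) (simp_all del: emeasure_completion)
      also have "\<dots> < \<infinity>"
        using B fin_ball by (auto simp: ennreal_powr_def ennreal_mult_less_top)
      finally show "Lp_norm q (fourier_integral \<phi>) < \<infinity>" .
    qed
    with g_conv show ?thesis by eventually_elim auto
  qed
  then have "Lp_norm q (fourier p f) \<le> Lp_norm q W"
    using q1 by (intro Lp_norm_mono_AE) auto
  also have "\<dots> \<le> (\<Sum>n. ennreal (a n)) * B_const TYPE('d) q"
    using W_bd U_sum by (rule order_trans)
  finally show ?thesis by (simp add: mult.commute)
qed

text \<open>
  Passing to the infimum over all representations: the bound holds for every \<open>t > L_norm p f\<close>, and
  multiplication by the finite constant is continuous.
\<close>

lemma fourier_le_B_const_L_norm: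
  fixes f :: "real^'d::finite \<Rightarrow> complex"
  assumes p: "1 < p" and q: "q = conj_exp p" and f: "f \<in> Lp_fun p"
    and B: "B_const TYPE('d) q < \<infinity>" and L: "L_norm p f < \<infinity>"
  shows "Lp_norm q (fourier p f) \<le> B_const TYPE('d) q * L_norm p f"
proof -
  have "Lp_norm q (fourier p f) \<le> B_const TYPE('d) q * t" if t: "L_norm p f < t" for t
  proof -
    from t obtain s where "s < t" and s: "s \<in> {\<Sum>n. ennreal (a n) | (a :: nat \<Rightarrow> real) (E :: nat \<Rightarrow> (real^'d) set).
     (\<forall>n. 0 \<le> a n) \<and>
     (\<forall>n. E n \<in> sets lebesgue \<and>
          0 < emeasure lebesgue (E n) \<and> emeasure lebesgue (E n) < \<infinity>) \<and>
     (AE x in lebesgue. ennreal (cmod (f x)) =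
        (\<Sum>n. ennreal (a n * measure lebesgue (E n) powr (- 1 / p) * indicator (E n) x)))}"
      unfolding L_norm_def Inf_less_iff by blast
    from s obtain a E where *: "s = (\<Sum>n. ennreal (a n))" "\<forall>n. 0 \<le> a n"
      "\<forall>n. E n \<in> sets lebesgue \<and> 0 < emeasure lebesgue (E n) \<and> emeasure lebesgue (E n) < \<infinity>"
      "AE x in lebesgue. ennreal (cmod (f x)) =
        (\<Sum>n. ennreal (a n * measure lebesgue (E n) powr (- 1 / p) * indicator (E n) x))"
      by blast
    have "Lp_norm q (fourier p f) \<le> B_const TYPE('d) q * s"
      unfolding *(1)
    proof (rule fourier_bound_of_representation[OF p q f B _ _ _ _ *(4)])
      show "(\<Sum>n. ennreal (a n)) < \<infinity>"
        using \<open>s < t\<close> unfolding *(1) by (auto intro: less_le_trans)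
    qed (use *(2,3) in blast)+
    also have "\<dots> \<le> B_const TYPE('d) q * t"
      using \<open>s < t\<close> by (intro mult_left_mono) auto
    finally show ?thesis .
  qed
  note above = this
  have "L_norm p f < L_norm p f + ennreal (inverse (real (Suc n)))" for n
    using L ennreal_add_left_cancel_less[of "L_norm p f" 0 "ennreal (inverse (real (Suc n)))"] by simp
  then have le: "Lp_norm q (fourier p f) \<le>
      B_const TYPE('d) q * (L_norm p f + ennreal (inverse (real (Suc n))))" for n
    by (rule above)
  have "(\<lambda>n. ennreal (inverse (real (Suc n)))) \<longlonglongrightarrow> 0"
    using tendsto_ennrealI[OF LIMSEQ_inverse_real_of_nat] by simp
  then have "(\<lambda>n. B_const TYPE('d) q * (L_norm p f + ennreal (inverse (real (Suc n))))) \<longlonglongrightarrow>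
      B_const TYPE('d) q * (L_norm p f + 0)"
    using B L by (intro tendsto_mult_ennreal tendsto_add tendsto_const) auto
  then have "Lp_norm q (fourier p f) \<le> B_const TYPE('d) q * (L_norm p f + 0)"
    by (rule LIMSEQ_le_const) (use le in blast)
  then show ?thesis by simp
qed

section \<open>Equality of the two suprema\<close>

theorem proposition2p1:
  fixes p q :: real
  assumes "2 < q" and "p = q / (q - 1)"
  shows "B_const TYPE('d::finite) q =
    (SUP f \<in> {f :: real^'d \<Rightarrow> complex. f \<in> Lp_fun p \<and> \<not> (AE x in lebesgue. f x = 0)}.
       if L_norm p f = \<infinity> then 0 else Lp_norm q (fourier p f) / L_norm p f)"
proof (rule antisym)
  let ?S = "{f :: real^'d \<Rightarrow> complex. f \<in> Lp_fun p \<and> \<not> (AE x in lebesgue. f x = 0)}"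
  let ?ratio = "\<lambda>f :: real^'d \<Rightarrow> complex. if L_norm p f = \<infinity> then 0 else Lp_norm q (fourier p f) / L_norm p f"
  have "p - 1 = 1 / (q - 1)"
    using assms by (simp add: field_simps)
  then have p: "1 < p" and conj: "conj_exp q = p" and conj': "q = conj_exp p"
    using assms by (auto simp: conj_exp_def)
  show "B_const TYPE('d) q \<le> (SUP f \<in> ?S. ?ratio f)"
    unfolding B_const_def conj
  proof (intro SUP_least)
    fix A and f :: "real^'d \<Rightarrow> complex"
    assume "A \<in> {E :: (real^'d) set. E \<in> sets lebesgue \<and> 0 < emeasure lebesgue E \<and> emeasure lebesgue E < \<infinity>}"
      and "f \<in> {f. f \<in> borel_measurable lebesgue \<and> (\<forall>x. cmod (f x) \<le> indicator A x)}"
    then have A: "A \<in> sets lebesgue" "0 < emeasure lebesgue A" "emeasure lebesgue A < \<infinity>"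
      and f: "f \<in> borel_measurable lebesgue" and bd: "\<And>x. cmod (f x) \<le> indicator A x" by auto
    have fin: "ennreal_powr (emeasure lebesgue A) (1 / p) < \<infinity>"
      using A by (auto simp: ennreal_powr_def)
    show "Lp_norm q (fourier p f) / ennreal_powr (emeasure lebesgue A) (1 / p) \<le> (SUP f \<in> ?S. ?ratio f)"
    proof (cases "AE x in lebesgue. f x = 0")
      case True
      have "fourier p f = (\<lambda>_. 0)"
        using integrable_indicator_bound[OF f A(1,3) bd] fourier_integral_zero_AE[OF True]
        by (auto simp: fourier_def)
      then show ?thesis by (simp add: Lp_norm_zero)
    next
      case False
      have L: "L_norm p f \<le> ennreal_powr (emeasure lebesgue A) (1 / p)"
        using p by (intro L_norm_indicator_bound A f bd) auto
      have "Lp_norm p f \<le> ennreal_powr (emeasure lebesgue A) (1 / p)"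
        using p by (intro Lp_norm_indicator_bound A bd) auto
      then have "f \<in> ?S"
        using False f fin by (auto simp: Lp_fun_def intro: le_less_trans)
      moreover have "Lp_norm q (fourier p f) / ennreal_powr (emeasure lebesgue A) (1 / p) \<le> ?ratio f"
      proof -
        have "L_norm p f \<noteq> \<infinity>" using L fin by (auto simp: top_unique)
        moreover have "Lp_norm q (fourier p f) / ennreal_powr (emeasure lebesgue A) (1 / p)
            \<le> Lp_norm q (fourier p f) / L_norm p f"
          unfolding divide_ennreal_def using L by (intro mult_left_mono inverse_ennreal_antimono) auto
        ultimately show ?thesis by simp
      qed
      ultimately show ?thesis by (rule SUP_upper2[where f = "?ratio"])
    qed
  qed
  show "(SUP f \<in> ?S. ?ratio f) \<le> B_const TYPE('d) q"
  proof (cases "B_const TYPE('d) q = \<infinity>")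
    case True
    then show ?thesis by simp
  next
    case False
    show ?thesis
    proof (rule SUP_least)
      fix f :: "real^'d \<Rightarrow> complex" assume "f \<in> ?S"
      then have f: "f \<in> Lp_fun p" by simp
      show "?ratio f \<le> B_const TYPE('d) q"
      proof (cases "L_norm p f = \<infinity>")
        case fin: False
        have le: "Lp_norm q (fourier p f) \<le> B_const TYPE('d) q * L_norm p f"
          using False fin by (intro fourier_le_B_const_L_norm[OF p conj' f]) (auto simp: less_top)
        \<comment> \<open>If \<open>L_norm p f = 0\<close>, then \<open>le\<close> makes the numerator 0, and \<open>0 / 0 = 0\<close> in \<open>ennreal\<close>.\<close>
        then have "Lp_norm q (fourier p f) / L_norm p f \<le> B_const TYPE('d) q"
          by (cases "L_norm p f = 0") (auto intro!: divide_le_posI_ennreal simp: mult.commute zero_less_iff_neq_zero)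
        then show ?thesis using fin by simp
      qed simp
    qed
  qed
qed

end
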